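(* For every function $\omega(n)$ with $\omega(n)\to\infty$ as $n\to\infty$, for all sufficiently large $n$, $$\frac{1}{\omega(n)}2^{-n/3}n^{-2}\le p_c(Q_{n,2},3)\le \omega(n)2^{-n/3}n^{-2}.$$
   Context: $Q_{n,k}$ is the graph with vertex set $\{0,1\}^n$ in which $x,y$ are adjacent iff $1\le d_H(x,y)\le k$ ($d_H$ = Hamming distance). The $r$-neighbor bootstrap percolation process from $\mathcal{A}_0\subset V$: $\mathcal{A}_i=\mathcal{A}_{i-1}\cup\{v: |N_v\cap\mathcal{A}_{i-1}|\ge r\}$, where $N_v$ is the neighborhood of $v$; it percolates if $\mathcal{A}_i=V$ for some $i$. In the random setting each vertex is placed in $\mathcal{A}_0$ independently with probability $p$, and $p_c(G,r)=\sup\{p\in(0,1): \mathbb{P}_p(\mathcal{A}_0 \text{ percolates on } G)\le 1/2\}$. $\omega(n)$ is an arbitrarily slowly growing function tending to infinity. *)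

theory Defs
  imports "HOL-Probability.Probability"
begin

text \<open>A finite simple graph is given by its vertex set \<open>V\<close> and a symmetric, irreflexive
  adjacency predicate \<open>E\<close>; only the values of \<open>E\<close> on \<open>V\<close> matter.\<close>

definition nbhd :: "'a set \<Rightarrow> ('a \<Rightarrow> 'a \<Rightarrow> bool) \<Rightarrow> 'a \<Rightarrow> 'a set" where
  "nbhd V E v = {u \<in> V. E v u}"

primrec bootstrap ::
  "'a set \<Rightarrow> ('a \<Rightarrow> 'a \<Rightarrow> bool) \<Rightarrow> nat \<Rightarrow> 'a set \<Rightarrow> nat \<Rightarrow> 'a set" where
  "bootstrap V E r A 0 = A"
| "bootstrap V E r A (Suc i) =
     bootstrap V E r A i \<union> {v \<in> V. card (nbhd V E v \<inter> bootstrap V E r A i) \<ge> r}"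

definition percolates :: "'a set \<Rightarrow> ('a \<Rightarrow> 'a \<Rightarrow> bool) \<Rightarrow> nat \<Rightarrow> 'a set \<Rightarrow> bool" where
  "percolates V E r A \<longleftrightarrow> (\<exists>i. bootstrap V E r A i = V)"

text \<open>For finite \<open>V\<close> and \<open>0 \<le> p \<le> 1\<close>; \<open>Pi_pmf\<close> takes one independent Bernoulli variable
  per element of \<open>V\<close>, and the value \<open>False\<close> off \<open>V\<close>.\<close>

definition random_subset :: "'a set \<Rightarrow> real \<Rightarrow> 'a set pmf" where
  "random_subset V p = map_pmf (\<lambda>f. {v \<in> V. f v}) (Pi_pmf V False (\<lambda>_. bernoulli_pmf p))"

definition critical_prob :: "'a set \<Rightarrow> ('a \<Rightarrow> 'a \<Rightarrow> bool) \<Rightarrow> nat \<Rightarrow> real" where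
  "critical_prob V E r =
     Sup {p. 0 < p \<and> p < 1 \<and>
             measure_pmf.prob (random_subset V p) {A. percolates V E r A} \<le> 1 / 2}"

text \<open>Points of $\{0,1\}^n$ are functions from \<open>{..<n}\<close> to \<open>bool\<close>, made canonical by
  being \<open>undefined\<close> outside \<open>{..<n}\<close>.\<close>

definition cube :: "nat \<Rightarrow> (nat \<Rightarrow> bool) set" where
  "cube n = {..<n} \<rightarrow>\<^sub>E UNIV"

definition hamming_dist :: "nat \<Rightarrow> (nat \<Rightarrow> bool) \<Rightarrow> (nat \<Rightarrow> bool) \<Rightarrow> nat" where
  "hamming_dist n x y = card {i. i < n \<and> x i \<noteq> y i}"

definition cube_adj :: "nat \<Rightarrow> nat \<Rightarrow> (nat \<Rightarrow> bool) \<Rightarrow> (nat \<Rightarrow> bool) \<Rightarrow> bool" where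
  "cube_adj n k x y \<longleftrightarrow> 1 \<le> hamming_dist n x y \<and> hamming_dist n x y \<le> k"

end

(* Lower bound: if no vertex has three neighbours in the initial set, nothing is ever infected, and
   the expected number of vertices with three such neighbours is of order 2^n n^6 p^3.

   Upper bound: three points obtained from a common vertex v by flipping disjoint pairs of coordinates
   infect v, then a 2-dimensional subcube, and then everything, because each vertex adjacent to an
   infected 2-dimensional subcube has three neighbours in it.  There are again about 2^n n^6 such
   triples; two of them sharing a point are rare enough for the second moment method to show that,
   for p well above 2^(-n/3) n^(-2), one of them is initially infected with probability above 1/2.
   The resulting error bound decreases in p, which replaces monotonicity of the percolation
   probability.  Drawing the three pairs from six disjoint coordinate blocks makes a triple recoverable
   from its points. *)

theory Submission
  imports Defs "HOL-Real_Asymp.Real_Asymp"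
begin

section \<open>Random subsets and the second moment method\<close>

lemma prob_random_subset_superset:
  assumes V: "finite V" and T: "T \<subseteq> V" and p: "0 \<le> p" "p \<le> 1"
  shows "measure_pmf.prob (random_subset V p) {A. T \<subseteq> A} = p ^ card T"
proof -
  \<comment> \<open>The event is a product set: \<open>True\<close> is forced on \<open>T\<close>
    and every other coordinate is free, so independence gives a product of probabilities.\<close>
  have "(\<lambda>f. {v \<in> V. f v}) -` {A. T \<subseteq> A} = Pi V (\<lambda>x. if x \<in> T then {True} else UNIV)"
    using T by (auto simp: Pi_def)
  then have "measure_pmf.prob (random_subset V p) {A. T \<subseteq> A}
      = (\<Prod>x\<in>V. measure_pmf.prob (bernoulli_pmf p) (if x \<in> T then {True} else UNIV))"
    using V by (simp add: random_subset_def measure_Pi_pmf_Pi)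
  also have "\<dots> = (\<Prod>x\<in>V. if x \<in> T then p else 1)"
    using p by (intro prod.cong) (auto simp: measure_pmf_single)
  also have "\<dots> = p ^ card T"
    using V T by (simp add: prod.If_cases Int_absorb1)
  finally show ?thesis .
qed

lemma set_random_subset: "finite V \<Longrightarrow> set_pmf (random_subset V p) \<subseteq> Pow V"
  by (auto simp: random_subset_def)

lemma integrable_random_subset:
  fixes f :: "'a set \<Rightarrow> real"
  assumes "finite V"
  shows "integrable (measure_pmf (random_subset V p)) f"
  using assms
  by (intro integrable_measure_pmf_finite finite_subset[OF set_random_subset]) auto

text \<open>Chebyshev's inequality for the number \<open>X\<close> of indices \<open>s\<close> with
  \<open>T s\<close> inside the random set. Two sets that share k points occur together with
  probability \<open>p ^ (2 * r - k)\<close>. Overlapping pairs thus contribute at most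
  \<open>card I * p ^ (2 * r)\<close> times the sum of \<open>D c / p ^ c\<close> to the variance,
  and dividing by the squared mean leaves the stated bound.\<close>

lemma prob_no_seed_le:
  fixes T :: "'i \<Rightarrow> 'a set" and D :: "nat \<Rightarrow> nat"
  assumes V: "finite V" and I: "finite I" "I \<noteq> {}" and p: "0 < p" "p \<le> 1"
    and T: "\<And>s. s \<in> I \<Longrightarrow> T s \<subseteq> V" "\<And>s. s \<in> I \<Longrightarrow> card (T s) = r"
    and D: "\<And>s c. s \<in> I \<Longrightarrow> 1 \<le> c \<Longrightarrow> c \<le> r \<Longrightarrow> card {t \<in> I. c \<le> card (T s \<inter> T t)} \<le> D c"
  shows "measure_pmf.prob (random_subset V p) {A. \<forall>s\<in>I. \<not> T s \<subseteq> A}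
    \<le> (\<Sum>c=1..r. real (D c) / p ^ c) / card I"
proof -
  let ?M = "measure_pmf (random_subset V p)"
  define N where "N = real (card I)"
  define \<mu> where "\<mu> = N * p ^ r"
  define X :: "'a set \<Rightarrow> real" where "X = (\<lambda>A. \<Sum>s\<in>I. indicator {A. T s \<subseteq> A} A)"
  note int = integrable_random_subset[OF V, of p]
  have "N > 0" using I by (simp add: N_def card_gt_0_iff)
  have mu2: "\<mu> ^ 2 = N ^ 2 * p ^ (2 * r)"
    by (simp add: \<mu>_def power_mult_distrib power_even_eq)
  have EX: "integral\<^sup>L ?M X = \<mu>"
  proof -
    have "integral\<^sup>L ?M X = (\<Sum>s\<in>I. measure ?M {A. T s \<subseteq> A})"
      unfolding X_def by (subst Bochner_Integration.integral_sum) (auto intro: int)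
    also have "\<dots> = (\<Sum>s\<in>I. p ^ r)"
      using T p V by (intro sum.cong) (auto simp: prob_random_subset_superset)
    finally show ?thesis by (simp add: \<mu>_def N_def)
  qed
  have "integral\<^sup>L ?M (\<lambda>A. X A ^ 2) = (\<Sum>s\<in>I. \<Sum>t\<in>I. measure ?M {A. T s \<union> T t \<subseteq> A})"
  proof -
    have "(\<lambda>A. X A ^ 2) = (\<lambda>A. \<Sum>s\<in>I. \<Sum>t\<in>I. indicator {A. T s \<union> T t \<subseteq> A} A)"
      unfolding X_def power2_eq_square sum_product
      by (intro ext sum.cong) (auto simp: indicator_def)
    then show ?thesis
      by (simp only:) (simp add: Bochner_Integration.integral_sum int)
  qed
  also have "\<dots> \<le> (\<Sum>s\<in>I. N * p ^ (2 * r) + (\<Sum>c=1..r. D c * p ^ (2 * r - c)))"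
  proof (rule sum_mono)
    fix s assume s: "s \<in> I"
    have "(\<Sum>t\<in>I. measure ?M {A. T s \<union> T t \<subseteq> A})
      \<le> (\<Sum>t\<in>I. p ^ (2 * r) + (\<Sum>c=1..r. if c \<le> card (T s \<inter> T t) then p ^ (2 * r - c) else 0))"
    proof (rule sum_mono)
      fix t assume t: "t \<in> I"
      define k where "k = card (T s \<inter> T t)"
      have fin: "finite (T s)" "finite (T t)"
        using s t T V by (meson finite_subset)+
      have "card (T s \<union> T t) + k = 2 * r"
        using card_Un_Int[OF fin] T(2)[OF s] T(2)[OF t] by (simp add: k_def)
      then have "measure ?M {A. T s \<union> T t \<subseteq> A} = p ^ (2 * r - k)"
        using T(1)[OF s] T(1)[OF t] V p
        by (subst prob_random_subset_superset) (auto intro!: arg_cong[of _ _ "power p"])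
      moreover have "k \<le> r"
        unfolding k_def using T(2)[OF s] fin by (metis card_mono inf_le1)
      \<comment> \<open>The right side over-counts on purpose: its summand for c = k alone suffices
        when k is positive, and \<open>p ^ (2 * r)\<close> when k = 0. This lets \<open>D c\<close>
        count overlaps of at least c points instead of exactly c.\<close>
      moreover have "p ^ (2 * r - k) \<le> p ^ (2 * r) + (\<Sum>c=1..r. if c \<le> k then p ^ (2 * r - c) else 0)"
      proof (cases "k = 0")
        case True
        then show ?thesis using p by (auto intro!: sum_nonneg)
      next
        case False
        then have "(\<Sum>c\<in>{k}. if c \<le> k then p ^ (2 * r - c) else 0)
            \<le> (\<Sum>c=1..r. if c \<le> k then p ^ (2 * r - c) else 0)"
          using p \<open>k \<le> r\<close> by (intro sum_mono2) auto
        then show ?thesis using p by (simp add: add_increasing)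
      qed
      ultimately show "measure ?M {A. T s \<union> T t \<subseteq> A} \<le> p ^ (2 * r)
          + (\<Sum>c=1..r. if c \<le> card (T s \<inter> T t) then p ^ (2 * r - c) else 0)"
        by (simp add: k_def)
    qed
    \<comment> \<open>Exchanging the sums over t and c turns the case distinction into the
      cardinality that \<open>D c\<close> bounds.\<close>
    also have "\<dots> = N * p ^ (2 * r)
        + (\<Sum>c=1..r. real (card {t \<in> I. c \<le> card (T s \<inter> T t)}) * p ^ (2 * r - c))"
      using I
      by (subst sum.distrib, subst sum.swap)
        (simp add: N_def sum.If_cases Int_def conj_commute cong: conj_cong)
    also have "\<dots> \<le> N * p ^ (2 * r) + (\<Sum>c=1..r. D c * p ^ (2 * r - c))"
      using D[OF s] p by (intro add_left_mono sum_mono mult_right_mono) auto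
    finally show "(\<Sum>t\<in>I. measure ?M {A. T s \<union> T t \<subseteq> A}) \<le> \<dots>" .
  qed
  also have "\<dots> = \<mu> ^ 2 + N * (\<Sum>c=1..r. D c * p ^ (2 * r - c))"
    by (simp add: \<mu>_def N_def algebra_simps power2_eq_square power_add[symmetric] mult_2_right)
  also have "(\<Sum>c=1..r. D c * p ^ (2 * r - c)) = p ^ (2 * r) * (\<Sum>c=1..r. D c / p ^ c)"
    unfolding sum_distrib_left using p by (intro sum.cong) (auto simp: power_diff)
  finally have EX2: "integral\<^sup>L ?M (\<lambda>A. X A ^ 2)
      \<le> \<mu> ^ 2 + N * (p ^ (2 * r) * (\<Sum>c=1..r. D c / p ^ c))" .
  \<comment> \<open>On the event \<open>X = 0\<close>, so there the squared deviation from the mean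
    is exactly \<open>\<mu> ^ 2\<close>.\<close>
  have "\<mu> ^ 2 * measure ?M {A. \<forall>s\<in>I. \<not> T s \<subseteq> A}
      = integral\<^sup>L ?M (\<lambda>A. \<mu> ^ 2 * indicator {A. \<forall>s\<in>I. \<not> T s \<subseteq> A} A)"
    by simp
  also have "\<dots> \<le> integral\<^sup>L ?M (\<lambda>A. (X A - \<mu>) ^ 2)"
    by (intro integral_mono int) (auto simp: indicator_def X_def)
  also have "\<dots> = integral\<^sup>L ?M (\<lambda>A. X A ^ 2) - \<mu> ^ 2"
    by (simp add: power2_diff int EX) (simp add: EX[unfolded X_def] X_def power2_eq_square)
  also have "\<dots> \<le> N * (p ^ (2 * r) * (\<Sum>c=1..r. D c / p ^ c))"
    using EX2 by simp
  finally have "\<mu> ^ 2 * measure ?M {A. \<forall>s\<in>I. \<not> T s \<subseteq> A} 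
      \<le> \<mu> ^ 2 * ((\<Sum>c=1..r. real (D c) / p ^ c) / N)"
    using \<open>N > 0\<close> unfolding mu2 by (simp add: power2_eq_square mult.assoc)
  then show ?thesis
    unfolding N_def[symmetric]
    by (rule mult_left_le_imp_le) (use \<open>N > 0\<close> p in \<open>simp add: \<mu>_def\<close>)
qed

section \<open>The union of all infection stages\<close>

lemma bootstrap_subset: "A \<subseteq> V \<Longrightarrow> bootstrap V E r A i \<subseteq> V"
  by (induction i) auto

lemma bootstrap_mono: "i \<le> j \<Longrightarrow> bootstrap V E r A i \<subseteq> bootstrap V E r A j"
  by (rule lift_Suc_mono_le) auto

lemma finite_subset_bootstrap_Union:
  assumes "finite S" "S \<subseteq> (\<Union>i. bootstrap V E r A i)"
  shows "\<exists>i. S \<subseteq> bootstrap V E r A i"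
  using assms
proof (induction S rule: finite_induct)
  case (insert x S)
  then obtain i j where "x \<in> bootstrap V E r A i" "S \<subseteq> bootstrap V E r A j"
    by auto
  then have "insert x S \<subseteq> bootstrap V E r A (max i j)"
    using bootstrap_mono[of i "max i j" V E r A] bootstrap_mono[of j "max i j" V E r A] by auto
  then show ?case ..
qed simp

lemma percolatesI:
  assumes "finite V" "A \<subseteq> V" "V \<subseteq> (\<Union>i. bootstrap V E r A i)"
  shows "percolates V E r A"
  using finite_subset_bootstrap_Union[OF assms(1,3)] bootstrap_subset[OF assms(2)]
  unfolding percolates_def by (meson subset_antisym)

text \<open>The stages increase and neighbourhoods are finite, so the infected neighbours in
  \<open>S\<close> all appear by a common stage. Arguing with the union of the stages avoids
  tracking infection times.\<close>

lemma bootstrap_Union_closed: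
  assumes "finite V" "v \<in> V" "S \<subseteq> nbhd V E v" "S \<subseteq> (\<Union>i. bootstrap V E r A i)" "r \<le> card S"
  shows "v \<in> (\<Union>i. bootstrap V E r A i)"
proof -
  have "finite (nbhd V E v)" using assms(1) by (simp add: nbhd_def)
  then obtain i where "S \<subseteq> bootstrap V E r A i"
    using finite_subset_bootstrap_Union[OF _ assms(4)] assms(3) by (meson finite_subset)
  then have "card S \<le> card (nbhd V E v \<inter> bootstrap V E r A i)"
    using assms(3) \<open>finite (nbhd V E v)\<close> by (intro card_mono) auto
  then have "v \<in> bootstrap V E r A (Suc i)" using assms by simp
  then show ?thesis by blast
qed

section \<open>Percolation in the cube from three disjoint pairs\<close>

text \<open>Exclusive or with the indicator of \<open>S\<close>. It takes \<open>v\<close> as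
  origin: cube points become subsets of the coordinates, and Hamming distance becomes the size of a
  symmetric difference.\<close>

definition flip :: "(nat \<Rightarrow> bool) \<Rightarrow> nat set \<Rightarrow> nat \<Rightarrow> bool" where
  "flip v S = (\<lambda>i. v i \<noteq> (i \<in> S))"

lemma flip_flip [simp]: "flip (flip v S) S = v"
  by (auto simp: flip_def)

lemma flip_eq_iff [simp]: "flip v S = flip v T \<longleftrightarrow> S = T"
  by (auto simp: flip_def fun_eq_iff)

lemma flip_in_cube: "v \<in> cube n \<Longrightarrow> S \<subseteq> {..<n} \<Longrightarrow> flip v S \<in> cube n"
  by (auto simp: flip_def cube_def PiE_def extensional_def)

lemma hamming_dist_flip:
  assumes "S \<subseteq> {..<n}" "T \<subseteq> {..<n}"
  shows "hamming_dist n (flip v S) (flip v T) = card (S - T \<union> (T - S))"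
  unfolding hamming_dist_def using assms
  by (intro arg_cong[of _ _ card]) (auto simp: flip_def)

lemma finite_cube: "finite (cube n)"
  by (simp add: cube_def finite_PiE)

lemma card_cube: "card (cube n) = 2 ^ n"
  by (simp add: cube_def card_PiE)

lemma flip_diff:
  assumes "v \<in> cube n" "w \<in> cube n"
  shows "flip v {i. i < n \<and> v i \<noteq> w i} = w"
proof
  fix i
  show "flip v {i. i < n \<and> v i \<noteq> w i} i = w i"
    using assms by (cases "i < n") (auto simp: flip_def cube_def PiE_def extensional_def)
qed

text \<open>Writing points as coordinate sets relative to \<open>v\<close>, the infection order is
  {}, {a,c}, {a}, {b}, which completes the square of subsets of {a,b}. Induction on the set of
  further flipped coordinates then carries this square to all its translates.\<close>

lemma three_pairs_percolate:
  assumes v: "v \<in> cube n" and A: "A \<subseteq> cube n"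
    and dist: "distinct [a, b, c, d, e, f]" and lt: "{a, b, c, d, e, f} \<subseteq> {..<n}"
    and seed: "flip v {a, b} \<in> A" "flip v {c, d} \<in> A" "flip v {e, f} \<in> A"
  shows "percolates (cube n) (cube_adj n 2) 3 A"
proof -
  define K where "K = (\<Union>i. bootstrap (cube n) (cube_adj n 2) 3 A i)"
  have "A \<subseteq> K"
    unfolding K_def by (rule order_trans[OF _ UN_upper[of 0]]) auto
  have closed: "x \<in> K" if "x \<in> cube n" "S \<subseteq> nbhd (cube n) (cube_adj n 2) x" "S \<subseteq> K" "card S = 3" for x S
    using bootstrap_Union_closed[OF finite_cube that(1,2), where r = 3 and A = A] that(3,4)
    by (simp add: K_def)
  \<comment> \<open>The case x = y is included so that \<open>{x, y}\<close> covers distances 1 and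
    2 alike.\<close>
  have nb: "flip v X \<in> nbhd (cube n) (cube_adj n 2) (flip v S)"
    if "S \<subseteq> {..<n}" "X \<subseteq> {..<n}" "S - X \<union> (X - S) = {x, y}" for S X x y
    using that v by (cases "x = y") (auto simp: nbhd_def cube_adj_def flip_in_cube hamming_dist_flip)
  have step: "flip v S \<in> K"
    if S: "S \<subseteq> {..<n}"
      and sub: "X \<subseteq> {..<n}" "Y \<subseteq> {..<n}" "Z \<subseteq> {..<n}"
      and inK: "flip v X \<in> K" "flip v Y \<in> K" "flip v Z \<in> K"
      and diff: "S - X \<union> (X - S) = {x1, x2}" "S - Y \<union> (Y - S) = {y1, y2}" "S - Z \<union> (Z - S) = {z1, z2}"
      and ne: "X \<noteq> Y" "X \<noteq> Z" "Y \<noteq> Z" for S X Y Z x1 x2 y1 y2 z1 z2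
  proof (rule closed)
    show "flip v S \<in> cube n" using v S by (rule flip_in_cube)
    show "{flip v X, flip v Y, flip v Z} \<subseteq> nbhd (cube n) (cube_adj n 2) (flip v S)"
      using nb[OF S sub(1) diff(1)] nb[OF S sub(2) diff(2)] nb[OF S sub(3) diff(3)] by simp
    show "{flip v X, flip v Y, flip v Z} \<subseteq> K" using inK by simp
    show "card {flip v X, flip v Y, flip v Z} = 3" using ne by simp
  qed
  have ab: "flip v {a, b} \<in> K" and cd: "flip v {c, d} \<in> K" and ef: "flip v {e, f} \<in> K"
    using seed \<open>A \<subseteq> K\<close> by auto
  have 0: "flip v {} \<in> K"
    by (rule step[OF _ _ _ _ ab cd ef, of _ a b c d e f]) (use dist lt in auto)
  have 1: "flip v {a, c} \<in> K"
    by (rule step[OF _ _ _ _ 0 ab cd, of _ a c b c a d]) (use dist lt in auto)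
  have 2: "flip v {a} \<in> K"
    by (rule step[OF _ _ _ _ 0 ab 1, of _ a a b b c c]) (use dist lt in auto)
  have 3: "flip v {b} \<in> K"
    by (rule step[OF _ _ _ _ 0 ab 2, of _ b b a a a b]) (use dist lt in auto)
  have all: "flip v (U \<union> W) \<in> K" if "finite U" "U \<subseteq> {..<n} - {a, b}" "W \<subseteq> {a, b}" for U W
    using that
  proof (induction U arbitrary: W rule: finite_induct)
    case empty
    then have "W = {} \<or> W = {a} \<or> W = {b} \<or> W = {a, b}" by auto
    then show ?case using 0 2 3 ab by auto
  next
    case (insert x U)
    \<comment> \<open>\<open>W' y\<close> toggles y in \<open>W\<close>. The point
      \<open>insert x U \<union> W\<close> has three neighbours in the infected square over
      \<open>U\<close>: drop x alone, drop x and toggle a, or drop x and toggle b.\<close>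
    define W' where "W' y = (if y \<in> W then W - {y} else insert y W)" for y
    have W': "W' y \<subseteq> {a, b}" if "y \<in> {a, b}" for y
      using that insert.prems by (auto simp: W'_def)
    have IH: "flip v (U \<union> T) \<in> K" "U \<union> T \<subseteq> {..<n}" if "T \<subseteq> {a, b}" for T
      using that insert.prems insert.IH lt by auto
    have S: "insert x U \<union> W \<subseteq> {..<n}"
      using insert.prems lt by auto
    have diff: "insert x U \<union> W - (U \<union> W' y) \<union> (U \<union> W' y - (insert x U \<union> W)) = {x, y}"
      if "y \<in> {a, b}" for y
      using that insert.prems insert.hyps by (auto simp: W'_def)
    have diff': "insert x U \<union> W - (U \<union> W) \<union> (U \<union> W - (insert x U \<union> W)) = {x, x}"
      using insert.prems insert.hyps by auto
    \<comment> \<open>Membership of a and b tells the three neighbours apart.\<close>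
    have mem: "a \<in> U \<union> W' a \<longleftrightarrow> a \<notin> U \<union> W" "b \<in> U \<union> W' b \<longleftrightarrow> b \<notin> U \<union> W"
      "a \<in> U \<union> W' b \<longleftrightarrow> a \<in> U \<union> W"
      using insert.prems dist by (auto simp: W'_def)
    then have "U \<union> W \<noteq> U \<union> W' a" "U \<union> W \<noteq> U \<union> W' b" "U \<union> W' a \<noteq> U \<union> W' b"
      by metis+
    then show ?case
      using step[OF S IH(2)[OF insert.prems(2)] IH(2)[OF W'[of a]] IH(2)[OF W'[of b]]
          IH(1)[OF insert.prems(2)] IH(1)[OF W'[of a]] IH(1)[OF W'[of b]]
          diff' diff[of a] diff[of b]]
      by simp
  qed
  have "cube n \<subseteq> K"
  proof
    fix w assume w: "w \<in> cube n"
    define S where "S = {i. i < n \<and> v i \<noteq> w i}"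
    have "flip v ((S - {a, b}) \<union> (S \<inter> {a, b})) \<in> K"
      by (rule all) (auto simp: S_def)
    moreover have "(S - {a, b}) \<union> (S \<inter> {a, b}) = S" by auto
    ultimately show "w \<in> K" using flip_diff[OF v w] by (simp add: S_def)
  qed
  then show ?thesis
    using percolatesI[OF finite_cube A] by (simp add: K_def)
qed

section \<open>A family of seeds in disjoint coordinate blocks, and its overlaps\<close>

text \<open>The coordinates are cut into blocks of length \<open>m\<close>; \<open>q\<close> holds
  an offset in block 2j and one in block 2j+1. Using two different blocks orders the pair, so
  \<open>q\<close> can be recovered from the set, and j is the quotient of either element by
  2m.\<close>

definition block_pair :: "nat \<Rightarrow> nat \<Rightarrow> nat \<times> nat \<Rightarrow> nat set" where
  "block_pair m j q = {2 * j * m + fst q, (2 * j + 1) * m + snd q}"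

text \<open>A seed is encoded by its center and three pairs of offsets, so the family is a product
  whose cardinality is immediate. Its blocks fit into the cube when
  \<open>6 * m \<le> n\<close>.\<close>

definition seeds :: "nat \<Rightarrow> nat \<Rightarrow> ((nat \<Rightarrow> bool) \<times> (nat \<Rightarrow> nat \<times> nat)) set" where
  "seeds n m = cube n \<times> ({..<3} \<rightarrow>\<^sub>E {..<m} \<times> {..<m})"

definition seed_point :: "nat \<Rightarrow> (nat \<Rightarrow> bool) \<times> (nat \<Rightarrow> nat \<times> nat) \<Rightarrow> nat \<Rightarrow> nat \<Rightarrow> bool" where
  "seed_point m s j = flip (fst s) (block_pair m j (snd s j))"

definition seed_set where
  "seed_set m s = seed_point m s ` {..<3}"

lemma block_pair_div:
  assumes "q \<in> {..<m} \<times> {..<m}" "i \<in> block_pair m j q"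
  shows "i div (2 * m) = j"
proof -
  have "2 * j * m + fst q = 2 * m * j + fst q" "(2 * j + 1) * m + snd q = 2 * m * j + (m + snd q)"
    by (simp_all add: algebra_simps)
  then have "i = 2 * m * j + fst q \<or> i = 2 * m * j + (m + snd q)"
    using assms(2) by (auto simp: block_pair_def)
  moreover have "0 < m" "fst q < 2 * m" "m + snd q < 2 * m" using assms(1) by auto
  ultimately show ?thesis by auto
qed

lemma block_pair_lt:
  assumes "q \<in> {..<m} \<times> {..<m}" "j < 3" "6 * m \<le> n"
  shows "block_pair m j q \<subseteq> {..<n}"
proof
  fix i assume i: "i \<in> block_pair m j q"
  have "0 < m" using assms(1) by auto
  then have "i < 2 * m * Suc (i div (2 * m))"
    using dividend_less_times_div[of "2 * m" i] by simp
  also have "\<dots> \<le> 2 * m * 3"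
    unfolding block_pair_div[OF assms(1) i] using assms(2) by (intro mult_le_mono2) auto
  finally show "i \<in> {..<n}" using assms(3) by auto
qed

lemma block_pair_inj:
  assumes "q \<in> {..<m} \<times> {..<m}" "q' \<in> {..<m} \<times> {..<m}" "block_pair m j q = block_pair m j q'"
  shows "q = q'"
  using assms by (cases q; cases q') (auto simp: block_pair_def doubleton_eq_iff)

lemma block_pair_disjoint:
  assumes "q \<in> {..<m} \<times> {..<m}" "q' \<in> {..<m} \<times> {..<m}" "j \<noteq> k"
  shows "block_pair m j q \<inter> block_pair m k q' = {}"
  using block_pair_div[OF assms(1)] block_pair_div[OF assms(2)] assms(3) by blast

lemma flip_flip_diff: "S \<inter> T = {} \<Longrightarrow> {i. flip v S i \<noteq> flip v T i} = S \<union> T"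
  by (auto simp: flip_def)

lemma seeds_snd: "s \<in> seeds n m \<Longrightarrow> j < 3 \<Longrightarrow> snd s j \<in> {..<m} \<times> {..<m}"
  by (auto simp: seeds_def PiE_def Pi_def)

text \<open>The center cancels when two points of a seed are compared: they differ exactly on the
  union of their two disjoint pairs, and the quotient by 2m singles out the j-th pair.\<close>

lemma block_pair_from_points:
  assumes s: "s \<in> seeds n m" and jk: "j < 3" "k < 3" "j \<noteq> k"
  shows "block_pair m j (snd s j) = {i. seed_point m s j i \<noteq> seed_point m s k i \<and> i div (2 * m) = j}"
proof -
  note q = seeds_snd[OF s jk(1)] seeds_snd[OF s jk(2)]
  have "{i. seed_point m s j i \<noteq> seed_point m s k i} = block_pair m j (snd s j) \<union> block_pair m k (snd s k)"
    unfolding seed_point_def by (rule flip_flip_diff[OF block_pair_disjoint[OF q jk(3)]])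
  then show ?thesis
    using block_pair_div[OF q(1), of _ j] block_pair_div[OF q(2), of _ k] jk(3) by blast
qed

lemma finite_seeds: "finite (seeds n m)"
  by (simp add: seeds_def finite_cube finite_PiE)

lemma card_seeds: "card (seeds n m) = 2 ^ n * (m * m) ^ 3"
  by (simp add: seeds_def card_cube card_cartesian_product card_PiE)

text \<open>Flipping is an involution, so one point together with its pair returns the
  center.\<close>

lemma seeds_eqI:
  assumes "s \<in> seeds n m" "t \<in> seeds n m" "\<And>j. j < 3 \<Longrightarrow> snd s j = snd t j"
    and "k < 3" "seed_point m s k = seed_point m t k"
  shows "s = t"
proof (rule prod_eqI)
  show "snd s = snd t"
  proof
    fix j show "snd s j = snd t j"
      using assms(1-3) by (cases "j < 3") (auto simp: seeds_def PiE_def extensional_def)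
  qed
  have "flip (seed_point m s k) (block_pair m k (snd s k)) = fst s"
    "flip (seed_point m t k) (block_pair m k (snd t k)) = fst t"
    by (simp_all add: seed_point_def)
  then show "fst s = fst t" using assms(3-5) by simp
qed

text \<open>One prescribed point determines the center from the three pairs, which all remain free;
  the symmetric difference of two prescribed points already determines both of their pairs.\<close>

lemma card_seeds_prescribed:
  assumes J: "J \<subseteq> {..<3}" "J \<noteq> {}"
  shows "card {t \<in> seeds n m. \<forall>j\<in>J. seed_point m t j = f j}
    \<le> (m * m) ^ (if card J = 1 then 3 else 3 - card J)"
proof -
  \<comment> \<open>The indices whose pairs are still free once the points in \<open>J\<close> are
    fixed; a seed in the set is determined by its pairs on \<open>L\<close>.\<close>
  define L where "L = (if card J = 1 then {..<3} else {..<3} - J)"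
  have "card {t \<in> seeds n m. \<forall>j\<in>J. seed_point m t j = f j}
    \<le> card (L \<rightarrow>\<^sub>E {..<m} \<times> {..<m})"
  proof (rule card_inj_on_le[where f = "\<lambda>t. restrict (snd t) L"])
    show "inj_on (\<lambda>t. restrict (snd t) L) {t \<in> seeds n m. \<forall>j\<in>J. seed_point m t j = f j}"
    proof (rule inj_onI, clarsimp)
      fix v q w r
      assume st: "(v, q) \<in> seeds n m" "(w, r) \<in> seeds n m"
        and sf: "\<forall>j\<in>J. seed_point m (v, q) j = f j" and tf: "\<forall>j\<in>J. seed_point m (w, r) j = f j"
        and eq: "restrict q L = restrict r L"
      have onL: "q j = r j" if "j \<in> L" for j
        using that eq by (metis restrict_apply')
      have "q j = r j" if j: "j < 3" for j
      proof (cases "j \<in> L")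
        case False
        then have jJ: "j \<in> J" "card J \<noteq> 1" using j by (auto simp: L_def split: if_splits)
        then have "J \<noteq> {j}" by auto
        \<comment> \<open>An index outside \<open>L\<close> lies in \<open>J\<close> and has a
          second prescribed index beside it, so its pair can be read off from two known
          points.\<close>
        then obtain k where k: "k \<in> J" "k \<noteq> j" using jJ(1) by auto
        then have "k < 3" using J(1) by auto
        have "block_pair m j (q j) = block_pair m j (r j)"
          using block_pair_from_points[OF st(1) j \<open>k < 3\<close> k(2)[symmetric]]
            block_pair_from_points[OF st(2) j \<open>k < 3\<close> k(2)[symmetric]] sf tf jJ(1) k(1)
          by simp
        then show ?thesis
          using seeds_snd[OF st(1) j] seeds_snd[OF st(2) j] by (intro block_pair_inj) auto
      qed (rule onL)
      moreover obtain k where "k \<in> J" using J(2) by auto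
      ultimately have "(v, q) = (w, r)"
        using seeds_eqI[OF st, of k] J(1) sf tf by auto
      then show "v = w \<and> q = r" by simp
    qed
  next
    show "(\<lambda>t. restrict (snd t) L) ` {t \<in> seeds n m. \<forall>j\<in>J. seed_point m t j = f j}
      \<subseteq> L \<rightarrow>\<^sub>E {..<m} \<times> {..<m}"
      using seeds_snd[of _ n m]
      by (intro image_subsetI) (auto simp only: L_def restrict_PiE_iff lessThan_iff mem_Collect_eq split: if_splits)
  qed (auto simp: L_def intro!: finite_PiE)
  also have "\<dots> = (m * m) ^ card L"
    by (simp add: L_def card_PiE card_cartesian_product)
  also have "card L = (if card J = 1 then 3 else 3 - card J)"
    using J(1) by (simp add: L_def card_Diff_subset finite_subset)
  finally show ?thesis .
qed

lemma inj_on_seed_point: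
  assumes "s \<in> seeds n m"
  shows "inj_on (seed_point m s) {..<3}"
proof (rule inj_onI, rule ccontr)
  fix j k :: nat
  assume jk: "j \<in> {..<3}" "k \<in> {..<3}" "seed_point m s j = seed_point m s k" "j \<noteq> k"
  then have "block_pair m j (snd s j) = {}"
    using block_pair_from_points[OF assms, of j k] by simp
  then show False by (simp add: block_pair_def)
qed

lemma card_seed_set: "s \<in> seeds n m \<Longrightarrow> card (seed_set m s) = 3"
  by (simp add: seed_set_def card_image inj_on_seed_point)

lemma seed_set_subset: "s \<in> seeds n m \<Longrightarrow> 6 * m \<le> n \<Longrightarrow> seed_set m s \<subseteq> cube n"
  using seeds_snd[of s n m]
  by (auto simp: seed_set_def seed_point_def seeds_def intro!: flip_in_cube dest: block_pair_lt[rotated 2])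

text \<open>Union bound: choose c indices of \<open>t\<close> whose points lie in the seed set of
  \<open>s\<close>, then one of its three points for each of them, and count the seeds with these
  points prescribed.\<close>

lemma card_seeds_overlap:
  assumes "s \<in> seeds n m" "1 \<le> c" "c \<le> 3"
  shows "card {t \<in> seeds n m. c \<le> card (seed_set m s \<inter> seed_set m t)}
    \<le> (3 choose c) * (3 ^ c * (m * m) ^ (if c = 1 then 3 else 3 - c))"
proof -
  define B where "B J f = {t \<in> seeds n m. \<forall>j\<in>J. seed_point m t j = f j}" for J f
  define \<J> where "\<J> = {J. J \<subseteq> {..<3::nat} \<and> card J = c}"
  define F where "F J = (J \<rightarrow>\<^sub>E seed_set m s)" for J :: "nat set"
  have finF: "finite (F J)" and cardF: "card (F J) = 3 ^ c" if "J \<in> \<J>" for J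
    using that finite_subset[of J "{..<3}"]
    by (auto simp: F_def \<J>_def card_PiE card_seed_set[OF assms(1)] intro!: finite_PiE)
      (simp add: seed_set_def)
  have finJ: "finite \<J>" by (simp add: \<J>_def)
  have "{t \<in> seeds n m. c \<le> card (seed_set m s \<inter> seed_set m t)} \<subseteq> (\<Union>J\<in>\<J>. \<Union>f\<in>F J. B J f)"
  proof clarify
    fix v q
    assume t: "(v, q) \<in> seeds n m" and c: "c \<le> card (seed_set m s \<inter> seed_set m (v, q))"
    \<comment> \<open>The points indexed by \<open>J0\<close> cover the intersection, so
      \<open>J0\<close> has at least c elements and contains a set \<open>J\<close> of exactly
      c.\<close>
    define J0 where "J0 = {j \<in> {..<3}. seed_point m (v, q) j \<in> seed_set m s}"
    have "seed_set m s \<inter> seed_set m (v, q) \<subseteq> seed_point m (v, q) ` J0"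
    proof
      fix x assume x: "x \<in> seed_set m s \<inter> seed_set m (v, q)"
      then obtain j where "j < 3" "x = seed_point m (v, q) j"
        by (auto simp: seed_set_def)
      then show "x \<in> seed_point m (v, q) ` J0"
        using x by (intro image_eqI[of _ _ j]) (simp_all add: J0_def)
    qed
    then have "card (seed_set m s \<inter> seed_set m (v, q)) \<le> card J0"
      by (rule surj_card_le[rotated]) (simp add: J0_def)
    then have "c \<le> card J0" using c by simp
    then obtain J where J: "J \<subseteq> J0" "card J = c" by (meson obtain_subset_with_card_n)
    then have "J \<in> \<J>" by (auto simp: \<J>_def J0_def)
    moreover have "restrict (seed_point m (v, q)) J \<in> F J"
      using J by (auto simp: F_def J0_def)
    moreover have "(v, q) \<in> B J (restrict (seed_point m (v, q)) J)"
      using t by (simp add: B_def)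
    ultimately show "(v, q) \<in> (\<Union>J\<in>\<J>. \<Union>f\<in>F J. B J f)" by blast
  qed
  then have "card {t \<in> seeds n m. c \<le> card (seed_set m s \<inter> seed_set m t)}
      \<le> card (\<Union>J\<in>\<J>. \<Union>f\<in>F J. B J f)"
    using finJ finF finite_seeds[of n m] by (intro card_mono finite_UN_I) (auto simp: B_def)
  also have "\<dots> \<le> (\<Sum>J\<in>\<J>. card (\<Union>f\<in>F J. B J f))"
    by (rule card_UN_le[OF finJ])
  also have "\<dots> \<le> (\<Sum>J\<in>\<J>. \<Sum>f\<in>F J. card (B J f))"
    by (intro sum_mono card_UN_le finF)
  also have "\<dots> \<le> (\<Sum>J\<in>\<J>. \<Sum>f\<in>F J. (m * m) ^ (if c = 1 then 3 else 3 - c))"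
  proof (intro sum_mono)
    fix J f assume "J \<in> \<J>"
    then have J: "J \<subseteq> {..<3}" "J \<noteq> {}" "card J = c" using assms(2) by (auto simp: \<J>_def)
    then show "card (B J f) \<le> (m * m) ^ (if c = 1 then 3 else 3 - c)"
      using card_seeds_prescribed[OF J(1,2), of n m f] unfolding B_def J(3) by (simp only:)
  qed
  also have "\<dots> = (3 choose c) * (3 ^ c * (m * m) ^ (if c = 1 then 3 else 3 - c))"
    by (simp add: cardF) (simp add: \<J>_def n_subsets)
  finally show ?thesis .
qed

section \<open>Percolation is likely above the threshold\<close>

lemma seed_percolates:
  assumes "s \<in> seeds n m" "6 * m \<le> n" "seed_set m s \<subseteq> A" "A \<subseteq> cube n"
  shows "percolates (cube n) (cube_adj n 2) 3 A"
proof -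
  have lt: "j < 3 \<Longrightarrow> fst (snd s j) < m \<and> snd (snd s j) < m" for j
    using seeds_snd[OF assms(1), of j] by auto
  have "seed_point m s j \<in> A" if "j < 3" for j using that assms(3) by (auto simp: seed_set_def)
  from this[of 0] this[of 1] this[of 2]
  have "flip (fst s) {fst (snd s 0), m + snd (snd s 0)} \<in> A"
    "flip (fst s) {2 * m + fst (snd s 1), 3 * m + snd (snd s 1)} \<in> A"
    "flip (fst s) {4 * m + fst (snd s 2), 5 * m + snd (snd s 2)} \<in> A"
    by (simp_all add: seed_point_def block_pair_def)
  moreover have "fst s \<in> cube n" using assms(1) by (simp add: seeds_def mem_Times_iff)
  moreover have "distinct [fst (snd s 0), m + snd (snd s 0), 2 * m + fst (snd s 1),
      3 * m + snd (snd s 1), 4 * m + fst (snd s 2), 5 * m + snd (snd s 2)]"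
    using lt[of 0] lt[of 1] lt[of 2] by simp
  moreover have "{fst (snd s 0), m + snd (snd s 0), 2 * m + fst (snd s 1),
      3 * m + snd (snd s 1), 4 * m + fst (snd s 2), 5 * m + snd (snd s 2)} \<subseteq> {..<n}"
    using lt[of 0] lt[of 1] lt[of 2] assms(2) by simp
  ultimately show ?thesis by (intro three_pairs_percolate[OF _ assms(4)])
qed

lemma prob_percolates_ge:
  assumes p: "0 < p" "p \<le> 1" and m: "0 < m" "6 * m \<le> n"
  shows "1 - 27 * (1 / (2 ^ n * p) + 1 / (2 ^ n * real m ^ 4 * p ^ 2) + 1 / (2 ^ n * real m ^ 6 * p ^ 3))
    \<le> measure_pmf.prob (random_subset (cube n) p) {A. percolates (cube n) (cube_adj n 2) 3 A}"
proof -
  let ?M = "measure_pmf (random_subset (cube n) p)"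
  let ?D = "\<lambda>c. (3 choose c) * (3 ^ c * (m * m) ^ (if c = 1 then 3 else 3 - c))"
  have ne: "seeds n m \<noteq> {}"
    using card_seeds[of n m] m(1) by auto
  have "1 - measure ?M {A. percolates (cube n) (cube_adj n 2) 3 A}
      = measure ?M (- {A. percolates (cube n) (cube_adj n 2) 3 A})"
    using measure_pmf.prob_compl[of "{A. percolates (cube n) (cube_adj n 2) 3 A}"]
    by (simp add: Compl_eq_Diff_UNIV)
  also have "\<dots> \<le> measure ?M {A. \<forall>s\<in>seeds n m. \<not> seed_set m s \<subseteq> A}"
  proof (intro measure_pmf.finite_measure_mono_AE AE_pmfI impI)
    fix A assume "A \<in> set_pmf (random_subset (cube n) p)"
      and A: "A \<in> - {A. percolates (cube n) (cube_adj n 2) 3 A}"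
    then have "A \<subseteq> cube n" using set_random_subset[OF finite_cube] by blast
    then show "A \<in> {A. \<forall>s\<in>seeds n m. \<not> seed_set m s \<subseteq> A}"
      using A seed_percolates m(2) by blast
  qed simp
  also have "\<dots> \<le> (\<Sum>c=1..3. real (?D c) / p ^ c) / card (seeds n m)"
    using finite_cube finite_seeds ne p
    by (rule prob_no_seed_le) (use m card_seed_set seed_set_subset card_seeds_overlap in auto)
  \<comment> \<open>The values for c = 1, 2, 3 are 9 m^6, 27 m^2 and 27; below, 27 serves as a
    common coefficient.\<close>
  also have "\<dots> = (9 * real m ^ 6 / p + 27 * real m ^ 2 / p ^ 2 + 27 / p ^ 3) / (2 ^ n * real m ^ 6)"
  proof -
    have "{1..3} = {1, 2, 3 :: nat}" by auto
    then have "(\<Sum>c=1..3. real (?D c) / p ^ c)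
        = 9 * real m ^ 6 / p + 27 * real m ^ 2 / p ^ 2 + 27 / p ^ 3"
      by (simp add: choose_two power_mult_distrib power2_eq_square flip: power_add)
    moreover have "real (card (seeds n m)) = 2 ^ n * real m ^ 6"
      by (simp add: card_seeds power_mult_distrib flip: power_add)
    ultimately show ?thesis by (simp only:)
  qed
  also have "\<dots> = 9 / (2 ^ n * p) + 27 / (2 ^ n * real m ^ 4 * p ^ 2) + 27 / (2 ^ n * real m ^ 6 * p ^ 3)"
    using m(1) p(1) by (simp add: field_simps eval_nat_numeral)
  also have "\<dots> \<le> 27 * (1 / (2 ^ n * p) + 1 / (2 ^ n * real m ^ 4 * p ^ 2) + 1 / (2 ^ n * real m ^ 6 * p ^ 3))"
    using p(1) by (simp add: divide_right_mono)
  finally show ?thesis by simp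
qed

section \<open>Percolation is unlikely below the threshold\<close>

text \<open>Every neighbour is reached by flipping some {i,j}, with i = j for distance 1; counting
  ordered pairs is crude but of the right order.\<close>

lemma card_nbhd_cube:
  assumes "v \<in> cube n"
  shows "card (nbhd (cube n) (cube_adj n 2) v) \<le> n * n"
proof -
  have "nbhd (cube n) (cube_adj n 2) v \<subseteq> (\<lambda>(i, j). flip v {i, j}) ` ({..<n} \<times> {..<n})"
  proof
    fix u assume "u \<in> nbhd (cube n) (cube_adj n 2) v"
    then have u: "u \<in> cube n" and adj: "cube_adj n 2 v u" by (auto simp: nbhd_def)
    define S where "S = {i. i < n \<and> v i \<noteq> u i}"
    have "card S = 1 \<or> card S = 2"
      using adj by (auto simp: cube_adj_def hamming_dist_def S_def)
    then obtain i j where "S = {i, j}"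
      by (metis card_1_singletonE card_2_iff insert_absorb2)
    moreover have "flip v S = u" using flip_diff[OF assms u] by (simp add: S_def)
    moreover have "S \<subseteq> {..<n}" by (auto simp: S_def)
    ultimately show "u \<in> (\<lambda>(i, j). flip v {i, j}) ` ({..<n} \<times> {..<n})" by force
  qed
  then have "card (nbhd (cube n) (cube_adj n 2) v)
      \<le> card ((\<lambda>(i, j). flip v {i, j}) ` ({..<n} \<times> {..<n}))"
    by (intro card_mono) auto
  also have "\<dots> \<le> card ({..<n} \<times> {..<n})" by (rule card_image_le) simp
  finally show ?thesis by (simp add: card_cartesian_product)
qed

text \<open>If no vertex has r neighbours in \<open>A\<close>, every stage equals \<open>A\<close>,
  so percolation forces \<open>A = V\<close>.\<close>

lemma percolates_trivial_or_infects:
  assumes "percolates V E r A" "A \<subseteq> V"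
  shows "V \<subseteq> A \<or> (\<exists>v\<in>V. r \<le> card (nbhd V E v \<inter> A))"
proof (rule ccontr)
  assume contr: "\<not> ?thesis"
  then have "bootstrap V E r A i = A" for i
    by (induction i) auto
  then show False using assms contr by (auto simp: percolates_def)
qed

text \<open>A union bound over vertices and r-subsets of their neighbourhoods; the term
  \<open>p ^ card V\<close> accounts for the set that is full from the start.\<close>

lemma prob_percolates_le:
  assumes V: "finite V" and p: "0 \<le> p" "p \<le> 1"
    and d: "\<And>v. v \<in> V \<Longrightarrow> card (nbhd V E v) \<le> d"
  shows "measure_pmf.prob (random_subset V p) {A. percolates V E r A}
    \<le> p ^ card V + real (card V * d ^ r) * p ^ r"
proof -
  let ?M = "measure_pmf (random_subset V p)"
  define \<S> where "\<S> v = {S. S \<subseteq> nbhd V E v \<and> card S = r}" for v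
  have fin: "finite (nbhd V E v)" for v using V by (simp add: nbhd_def)
  then have finS: "finite (\<S> v)" for v by (simp add: \<S>_def)
  have cardS: "card (\<S> v) \<le> d ^ r" if "v \<in> V" for v
  proof -
    have "card (\<S> v) = card (nbhd V E v) choose r" by (simp add: \<S>_def n_subsets fin)
    also have "\<dots> \<le> card (nbhd V E v) ^ r"
      by (cases "r \<le> card (nbhd V E v)") (auto intro: binomial_le_pow simp: binomial_eq_0)
    also have "\<dots> \<le> d ^ r" using d[OF that] by (rule power_mono) simp
    finally show ?thesis .
  qed
  have "measure ?M {A. percolates V E r A}
      \<le> measure ?M ({A. V \<subseteq> A} \<union> (\<Union>v\<in>V. \<Union>S\<in>\<S> v. {A. S \<subseteq> A}))"
  proof (intro measure_pmf.finite_measure_mono_AE AE_pmfI impI)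
    fix A assume "A \<in> set_pmf (random_subset V p)" "A \<in> {A. percolates V E r A}"
    then have "V \<subseteq> A \<or> (\<exists>v\<in>V. r \<le> card (nbhd V E v \<inter> A))"
      using set_random_subset[OF V] by (intro percolates_trivial_or_infects) auto
    then show "A \<in> {A. V \<subseteq> A} \<union> (\<Union>v\<in>V. \<Union>S\<in>\<S> v. {A. S \<subseteq> A})"
    proof
      assume "\<exists>v\<in>V. r \<le> card (nbhd V E v \<inter> A)"
      then obtain v S where "v \<in> V" "S \<subseteq> nbhd V E v \<inter> A" "card S = r"
        by (meson obtain_subset_with_card_n)
      then show ?thesis by (auto simp: \<S>_def)
    qed simp
  qed simp
  also have "\<dots> \<le> measure ?M {A. V \<subseteq> A} + measure ?M (\<Union>v\<in>V. \<Union>S\<in>\<S> v. {A. S \<subseteq> A})"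
    by (rule measure_subadditive) auto
  also have "measure ?M (\<Union>v\<in>V. \<Union>S\<in>\<S> v. {A. S \<subseteq> A})
      \<le> (\<Sum>v\<in>V. measure ?M (\<Union>S\<in>\<S> v. {A. S \<subseteq> A}))"
    using V by (intro measure_pmf.finite_measure_subadditive_finite) auto
  also have "\<dots> \<le> (\<Sum>v\<in>V. \<Sum>S\<in>\<S> v. measure ?M {A. S \<subseteq> A})"
    using finS by (intro sum_mono measure_pmf.finite_measure_subadditive_finite) auto
  also have "\<dots> = (\<Sum>v\<in>V. \<Sum>S\<in>\<S> v. p ^ r)"
  proof (intro sum.cong refl)
    fix v S assume "S \<in> \<S> v"
    then have "S \<subseteq> V" "card S = r" by (auto simp: \<S>_def nbhd_def)
    then show "measure ?M {A. S \<subseteq> A} = p ^ r"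
      using prob_random_subset_superset[OF V _ p] by simp
  qed
  also have "\<dots> \<le> (\<Sum>v\<in>V. d ^ r * p ^ r)"
  proof (rule sum_mono)
    fix v assume "v \<in> V"
    then have "real (card (\<S> v)) \<le> real (d ^ r)" using cardS by (simp only: of_nat_le_iff)
    then show "(\<Sum>S\<in>\<S> v. p ^ r) \<le> d ^ r * p ^ r" using p by (simp add: mult_right_mono)
  qed
  also have "\<dots> = real (card V * d ^ r) * p ^ r" by simp
  also have "measure ?M {A. V \<subseteq> A} = p ^ card V"
    using prob_random_subset_superset[OF V _ p] by simp
  finally show ?thesis by simp
qed

section \<open>Numerical estimates and the critical probability\<close>

text \<open>Here x stands for n, y for 2^(n/3) and M for \<open>n div 6\<close>. Since 1728 = 12^3,
  passing from x to 12 M leaves y M^2 p at least 12. The three denominators are then at least 1728,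
  144 and 1728, so the error is at most 7/32.\<close>

lemma second_moment_error_small:
  fixes x y M p :: real
  assumes x: "0 < x" "x \<le> y" "1 \<le> y" and M: "x \<le> 12 * M" and p: "0 < p" "1728 \<le> y * x ^ 2 * p"
  shows "27 * (1 / (y ^ 3 * p) + 1 / (y ^ 3 * M ^ 4 * p ^ 2) + 1 / (y ^ 3 * M ^ 6 * p ^ 3)) < 1 / 2"
proof -
  have M0: "0 < M" using x M by simp
  have "1728 \<le> y * y ^ 2 * p"
    using p x by (smt (verit) mult_left_mono mult_right_mono power_mono)
  then have *: "1728 \<le> y ^ 3 * p" by (simp add: power3_eq_cube power2_eq_square mult.assoc)
  have "y * x ^ 2 * p \<le> y * (12 * M) ^ 2 * p"
    using x M p by (intro mult_right_mono mult_left_mono power_mono) auto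
  then have **: "12 \<le> y * M ^ 2 * p" using p by (simp add: power_mult_distrib)
  have "12 ^ 2 \<le> (y * M ^ 2 * p) ^ 2" using ** by (rule power_mono) simp
  also have "\<dots> = y ^ 2 * M ^ 4 * p ^ 2" by (simp add: power_mult_distrib)
  also have "\<dots> \<le> y ^ 3 * M ^ 4 * p ^ 2"
    using x p M0 by (intro mult_right_mono power_increasing) auto
  finally have 2: "144 \<le> y ^ 3 * M ^ 4 * p ^ 2" by simp
  have "12 ^ 3 \<le> (y * M ^ 2 * p) ^ 3" using ** by (rule power_mono) simp
  also have "\<dots> = y ^ 3 * M ^ 6 * p ^ 3" by (simp add: power_mult_distrib)
  finally have 3: "1728 \<le> y ^ 3 * M ^ 6 * p ^ 3" by simp
  have "1 / (y ^ 3 * p) \<le> 1 / 1728" "1 / (y ^ 3 * M ^ 4 * p ^ 2) \<le> 1 / 144"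
    "1 / (y ^ 3 * M ^ 6 * p ^ 3) \<le> 1 / 1728"
    using * 2 3 by (intro divide_left_mono; simp)+
  then show ?thesis by simp
qed

theorem theorem3p2:
  fixes \<omega> :: "nat \<Rightarrow> real"
  assumes "filterlim \<omega> at_top at_top"
  shows "\<forall>\<^sub>F n in at_top.
    1 / \<omega> n * 2 powr (- (real n / 3)) * real n powi (-2)
      \<le> critical_prob (cube n) (cube_adj n 2) 3 \<and>
    critical_prob (cube n) (cube_adj n 2) 3
      \<le> \<omega> n * 2 powr (- (real n / 3)) * real n powi (-2)"
proof -
  have "\<forall>\<^sub>F n in at_top. 1728 \<le> \<omega> n"
    using assms by (simp add: filterlim_at_top)
  \<comment> \<open>Together with p above the threshold, this makes 2^n p large and so controls
    pairs of seeds that share one point.\<close>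
  moreover have "\<forall>\<^sub>F n in at_top. real n \<le> 2 powr (real n / 3)"
    by real_asymp
  moreover have "\<forall>\<^sub>F n in at_top. 6 \<le> (n :: nat)"
    by (rule eventually_ge_at_top)
  ultimately show ?thesis
  proof eventually_elim
    fix n :: nat
    assume w: "1728 \<le> \<omega> n" and ny: "real n \<le> 2 powr (real n / 3)" and n6: "6 \<le> n"
    define y where "y = 2 powr (real n / 3)"
    define x where "x = real n"
    define P where "P = {p. 0 < p \<and> p < 1 \<and> measure_pmf.prob (random_subset (cube n) p)
      {A. percolates (cube n) (cube_adj n 2) 3 A} \<le> 1 / 2}"
    have xy: "6 \<le> x" "x \<le> y" using n6 ny by (simp_all add: x_def y_def)
    have y3: "y ^ 3 = 2 ^ n"
      by (simp add: y_def powr_power powr_realpow)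
    have eqs: "2 powr (- (real n / 3)) = 1 / y" "real n powi (-2) = 1 / x ^ 2"
      by (simp_all add: y_def x_def powr_minus_divide power_int_def field_simps)
    \<comment> \<open>The claimed lower bound itself, chosen so that y x^2 q = 1 /
      \<open>\<omega> n\<close>.\<close>
    define q where "q = 1 / (\<omega> n * y * x ^ 2)"
    have "1728 * 1 * 1 \<le> \<omega> n * y * x ^ 2"
      using w xy by (intro mult_mono one_le_power) auto
    then have q: "0 < q" "q \<le> 1 / 1728"
      unfolding q_def by (auto intro!: divide_left_mono simp: field_simps)
    \<comment> \<open>This yields the lower bound and also that \<open>P\<close> is nonempty, as the
      upper estimate of its supremum requires.\<close>
    have "q \<in> P"
    proof -
      have "measure_pmf.prob (random_subset (cube n) q) {A. percolates (cube n) (cube_adj n 2) 3 A}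
          \<le> q ^ card (cube n) + real (card (cube n) * (n * n) ^ 3) * q ^ 3"
        by (intro prob_percolates_le finite_cube) (use q card_nbhd_cube in auto)
      also have "real (card (cube n) * (n * n) ^ 3) * q ^ 3 = (y * x ^ 2 * q) ^ 3"
        by (simp add: card_cube y3 power_mult_distrib x_def power2_eq_square)
      also have "y * x ^ 2 * q = 1 / \<omega> n"
        using xy w by (simp add: q_def)
      also have "(1 / \<omega> n) ^ 3 \<le> (1 / 1728) ^ 3"
        using w by (intro power_mono divide_left_mono) auto
      also have "q ^ card (cube n) \<le> q ^ 1"
        using q by (intro power_decreasing) (auto simp: card_cube)
      finally have "measure_pmf.prob (random_subset (cube n) q)
          {A. percolates (cube n) (cube_adj n 2) 3 A} \<le> 1 / 2"
        using q(2) by (simp add: power3_eq_cube)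
      then show ?thesis using q by (simp add: P_def)
    qed
    \<comment> \<open>The error estimate applies to each p above the bound separately, so none of
      them lies in \<open>P\<close>.\<close>
    have upper: "p \<le> \<omega> n / (y * x ^ 2)" if "p \<in> P" for p
    proof (rule ccontr)
      assume "\<not> ?thesis"
      then have "\<omega> n < y * x ^ 2 * p" using xy by (simp add: field_simps)
      moreover have p: "0 < p" "p < 1" using that by (auto simp: P_def)
      moreover have "x \<le> 12 * real (n div 6)"
      proof -
        \<comment> \<open>For n at least 6, rounding n / 6 down loses at most half of it.\<close>
        have "n \<le> 12 * (n div 6)" using n6 by presburger
        then have "real n \<le> real (12 * (n div 6))" by (simp only: of_nat_le_iff)
        then show ?thesis by (simp add: x_def)
      qed
      ultimately have "27 * (1 / (2 ^ n * p) + 1 / (2 ^ n * real (n div 6) ^ 4 * p ^ 2)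
          + 1 / (2 ^ n * real (n div 6) ^ 6 * p ^ 3)) < 1 / 2"
        unfolding y3[symmetric] using xy w by (intro second_moment_error_small) auto
      moreover have "0 < n div 6" "6 * (n div 6) \<le> n" using n6 by auto
      ultimately have "1 / 2 < measure_pmf.prob (random_subset (cube n) p)
          {A. percolates (cube n) (cube_adj n 2) 3 A}"
        using prob_percolates_ge[of p "n div 6" n] p by linarith
      then show False using that by (simp add: P_def)
    qed
    have "q \<le> Sup P"
      using \<open>q \<in> P\<close> upper by (intro cSup_upper bdd_aboveI)
    moreover have "Sup P \<le> \<omega> n / (y * x ^ 2)"
      using \<open>q \<in> P\<close> upper by (intro cSup_least) auto
    ultimately show "1 / \<omega> n * 2 powr (- (real n / 3)) * real n powi (-2)
        \<le> critical_prob (cube n) (cube_adj n 2) 3 \<and>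
      critical_prob (cube n) (cube_adj n 2) 3
        \<le> \<omega> n * 2 powr (- (real n / 3)) * real n powi (-2)"
      unfolding critical_prob_def P_def[symmetric] eqs by (simp add: q_def)
  qed
qed

end
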